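(* Let $\{x^n\}_n$ be generated by Algorithm pABBDCA$_{\mathrm{er}}$ (described in the context) for minimizing $E=f+g_1-g_2$. Assume that $\nabla f$ and $\nabla g_1$ are Lipschitz continuous (with $g_1$ continuously differentiable) and that $E$ is a KL function. Then the sequence $\{x^n\}_n$ globally converges to a critical point $x^*$ with $$\sum_{n=0}^{\infty}\|x^{n+1}-x^n\|<\infty.$$
   Context: Setting. $X$ is a finite-dimensional real Hilbert space with inner product $\langle\cdot,\cdot\rangle$ and norm $\|\cdot\|$. $E(x)=f(x)+g_1(x)-g_2(x)$, where $f$ is convex and continuously differentiable with $L$-Lipschitz gradient, and $g_1,g_2$ are proper closed convex functions. For a convex function, $\partial$ is the convex subdifferential. Standing assumptions: $E$ is bounded from below and all level sets $\{x:E(x)\le\alpha\}$, $\alpha\in\mathbb{R}$, are compact. When $g_1$ is differentiable, $\partial E(x):=\nabla f(x)+\nabla g_1(x)-\partial g_2(x)$; $x$ is a critical point if $0\in\partial E(x)$. $\mathrm{dist}(0,S)=\inf_{s\in S}\|s\|$. KL function. A closed proper function $h$ is a KL function if for any critical point $\bar x$ of $h$ there exist $\nu\in(0,+\infty]$, a neighborhood $\mathcal{O}$ of $\bar x$ and a continuous concave function $\psi:[0,\nu)\to[0,+\infty)$ with $\psi(0)=0$ such that $\psi$ is continuously differentiable on $(0,\nu)$ with $\psi'>0$ there, and for every $x\in\mathcal{O}$ with $h(\bar x)<h(x)<h(\bar x)+\nu$ one has $\psi'(h(x)-h(\bar x))\cdot\mathrm{dist}(0,\partial h(x))\ge1$.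 Algorithm pABBDCA$_{\mathrm{er}}$. Inputs: $x^0\in X$, $\alpha_0>0$, $0<\alpha_{\min}<\alpha_{\max}$, initial trial step $\lambda_0=1$, $\rho,\overline\beta,\omega\in(0,1)$, $0<\eta<1/\alpha_{\max}$, integer $N_{\max}\ge1$; $x^{-1}=x^0$. For $n=0,1,2,\dots$: 1. Set $\beta_n=\min\{\frac{n-1}{n+2},\overline\beta\}$ and $y^n=x^n+\beta_n(x^n-x^{n-1})$. Choose $\xi^n\in\partial g_2(x^n)$ and set $u^n=\arg\min_x\{\langle-\xi^n,x-y^n\rangle+\frac{1}{2\alpha_n}\|x-y^n\|^2+f(x)+g_1(x)\}$. 2. Set $d^n=u^n-x^n$, $\nu_n=\frac{\omega}{n+1}\|d^n\|^2$. If $d^n=0$, stop. 3. (Line search and restart) Find the smallest integer $k\ge0$ such that $\lambda_n=\lambda_0\rho^k$ (here $\lambda_0=1$ is the initial trial step) satisfies $E(x^n+\lambda_nd^n)\le E(x^n)-\eta\lambda_n\|d^n\|^2+\nu_n$. If $k>N_{\max}$ and $\beta_n>0$, restart: set $\beta_n=0$, $y^n=x^n$, recompute $u^n,d^n,\nu_n$ with these values, and repeat the line search. 4. Set $x^{n+1}=x^n+\lambda_nd^n$, $s^n=x^{n+1}-y^n$, $y_{bb}^n=\nabla f(x^{n+1})-\nabla f(y^n)$. 5. If $\langle s^n,y_{bb}^n\rangle>0$, set $\alpha_{n+1}=\max\{\alpha_{\min},\min\{\alpha_{\max},\tau_n\}\}$ with $\tau_n=\langle s^n,s^n\rangle/\langle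 s^n,y_{bb}^n\rangle$ for $n$ even and $\tau_n=\langle s^n,y_{bb}^n\rangle/\langle y_{bb}^n,y_{bb}^n\rangle$ for $n$ odd; otherwise $\alpha_{n+1}=\alpha_{\max}$. The sequences considered are infinite (no stopping rule other than $d^n=0$, and the algorithm does not stop). *)

theory Defs
  imports "HOL-Analysis.Analysis"
begin

definition ereal_epigraph :: "('a \<Rightarrow> ereal) \<Rightarrow> ('a \<times> real) set" where
  "ereal_epigraph h = {(x, r). h x \<le> ereal r}"

definition proper_closed :: "('a::topological_space \<Rightarrow> ereal) \<Rightarrow> bool" where
  "proper_closed h \<longleftrightarrow>
     (\<forall>x. h x \<noteq> -\<infinity>) \<and> (\<exists>x. h x \<noteq> \<infinity>) \<and> closed (ereal_epigraph h)"

(* The library's convex_on covers real-valued functions only, so convexity is stated through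
   the epigraph. *)
definition proper_closed_convex :: "('a::real_normed_vector \<Rightarrow> ereal) \<Rightarrow> bool" where
  "proper_closed_convex h \<longleftrightarrow> proper_closed h \<and> convex (ereal_epigraph h)"

(* Empty outside the effective domain. *)
definition subdifferential :: "('a::real_inner \<Rightarrow> ereal) \<Rightarrow> 'a \<Rightarrow> 'a set" where
  "subdifferential g x =
     {v. \<bar>g x\<bar> \<noteq> \<infinity> \<and> (\<forall>y. g x + ereal (v \<bullet> (y - x)) \<le> g y)}"

(* Where g2 = \<infinity> the objective is -\<infinity>; this is excluded only once E is assumed to be bounded
   from below. *)
definition dc_objective ::
    "('a \<Rightarrow> real) \<Rightarrow> ('a \<Rightarrow> real) \<Rightarrow> ('a \<Rightarrow> ereal) \<Rightarrow> 'a \<Rightarrow> ereal" where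
  "dc_objective f g1 g2 x = ereal (f x + g1 x) - g2 x"

(* Df and Dg1 are the gradients of f and g1. *)
definition dc_subdifferential ::
    "('a::real_inner \<Rightarrow> 'a) \<Rightarrow> ('a \<Rightarrow> 'a) \<Rightarrow> ('a \<Rightarrow> ereal) \<Rightarrow> 'a \<Rightarrow> 'a set" where
  "dc_subdifferential Df Dg1 g2 x = {Df x + Dg1 x - \<xi> |\<xi>. \<xi> \<in> subdifferential g2 x}"

(* Unlike infdist, this is \<infinity> for the empty set. *)
definition dist_origin :: "'a::real_normed_vector set \<Rightarrow> ereal" where
  "dist_origin S = (INF s\<in>S. ereal (norm s))"

(* The subdifferential of h is a parameter dh, because for a difference of convex functions it
   depends on the decomposition. *)
definition KL_function ::
    "('a::real_normed_vector \<Rightarrow> ereal) \<Rightarrow> ('a \<Rightarrow> 'a set) \<Rightarrow> bool" where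
  "KL_function h dh \<longleftrightarrow> proper_closed h \<and>
     (\<forall>xbar. 0 \<in> dh xbar \<longrightarrow>
       (\<exists>(\<nu>::ereal) U (\<psi>::real \<Rightarrow> real) \<psi>'.
          0 < \<nu> \<and> open U \<and> xbar \<in> U \<and>
          continuous_on {t. 0 \<le> t \<and> ereal t < \<nu>} \<psi> \<and>
          concave_on {t. 0 \<le> t \<and> ereal t < \<nu>} \<psi> \<and>
          (\<forall>t. 0 \<le> t \<and> ereal t < \<nu> \<longrightarrow> 0 \<le> \<psi> t) \<and>
          \<psi> 0 = 0 \<and>
          (\<forall>t. 0 < t \<and> ereal t < \<nu> \<longrightarrow> (\<psi> has_real_derivative \<psi>' t) (at t)) \<and>
          continuous_on {t. 0 < t \<and> ereal t < \<nu>} \<psi>' \<and>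
          (\<forall>t. 0 < t \<and> ereal t < \<nu> \<longrightarrow> 0 < \<psi>' t) \<and>
          (\<forall>x\<in>U. h xbar < h x \<and> h x < h xbar + \<nu> \<longrightarrow>
             1 \<le> ereal (\<psi>' (real_of_ereal (h x - h xbar))) * dist_origin (dh x))))"

definition is_prox_point ::
    "('a::real_inner \<Rightarrow> real) \<Rightarrow> ('a \<Rightarrow> real) \<Rightarrow> real \<Rightarrow> 'a \<Rightarrow> 'a \<Rightarrow> 'a \<Rightarrow> bool" where
  "is_prox_point f g1 a \<xi> y u \<longleftrightarrow>
     is_arg_min (\<lambda>z. (- \<xi>) \<bullet> (z - y) + 1 / (2 * a) * (norm (z - y))\<^sup>2 + f z + g1 z)
       (\<lambda>_. True) u"

(* The last summand is the nonmonotone slack nu_n of iteration n. *)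
definition sufficient_decrease ::
    "('a::real_normed_vector \<Rightarrow> ereal) \<Rightarrow> real \<Rightarrow> real \<Rightarrow> nat \<Rightarrow> 'a \<Rightarrow> 'a \<Rightarrow> real \<Rightarrow> bool" where
  "sufficient_decrease E \<eta> \<omega> n x d l \<longleftrightarrow>
     E (x + l *\<^sub>R d) \<le>
       E x - ereal (\<eta> * l * (norm d)\<^sup>2) + ereal (\<omega> / (real n + 1) * (norm d)\<^sup>2)"

(* The initial trial step is 1, so the k-th trial step is \<rho> ^ k. *)
definition backtracking_index ::
    "('a::real_normed_vector \<Rightarrow> ereal) \<Rightarrow> real \<Rightarrow> real \<Rightarrow> real \<Rightarrow> nat \<Rightarrow> 'a \<Rightarrow> 'a \<Rightarrow> nat \<Rightarrow> bool"
  where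
  "backtracking_index E \<eta> \<omega> \<rho> n x d k \<longleftrightarrow>
     sufficient_decrease E \<eta> \<omega> n x d (\<rho> ^ k) \<and>
     (\<forall>j<k. \<not> sufficient_decrease E \<eta> \<omega> n x d (\<rho> ^ j))"

definition bb_stepsize :: "real \<Rightarrow> real \<Rightarrow> nat \<Rightarrow> 'a::real_inner \<Rightarrow> 'a \<Rightarrow> real" where
  "bb_stepsize \<alpha>min \<alpha>max n s v =
     (if s \<bullet> v > 0
      then max \<alpha>min (min \<alpha>max (if even n then (s \<bullet> s) / (s \<bullet> v) else (s \<bullet> v) / (v \<bullet> v)))
      else \<alpha>max)"

definition extrapolation :: "real \<Rightarrow> nat \<Rightarrow> real" where
  "extrapolation \<beta>bar n = min ((real n - 1) / (real n + 2)) \<beta>bar"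

(* One iteration: from the proximal step size a and the iterates xprev, x it produces the
   extrapolated point y actually used (reset to x by a restart) and the next iterate xnew.
   The stopping test concerns the direction computed before a possible restart, and a restart
   keeps the subgradient \<xi>. *)
definition pABBDCA_er_step ::
    "('a::real_inner \<Rightarrow> real) \<Rightarrow> ('a \<Rightarrow> real) \<Rightarrow> ('a \<Rightarrow> ereal) \<Rightarrow>
     real \<Rightarrow> real \<Rightarrow> real \<Rightarrow> real \<Rightarrow> nat \<Rightarrow> nat \<Rightarrow> real \<Rightarrow> 'a \<Rightarrow> 'a \<Rightarrow> 'a \<Rightarrow> 'a \<Rightarrow> bool" where
  "pABBDCA_er_step f g1 g2 \<rho> \<beta>bar \<omega> \<eta> Nmax n a xprev x y xnew \<longleftrightarrow>
     (let E = dc_objective f g1 g2;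
          \<beta> = extrapolation \<beta>bar n;
          y0 = x + \<beta> *\<^sub>R (x - xprev)
      in \<exists>\<xi> u0 k0.
           \<xi> \<in> subdifferential g2 x \<and>
           is_prox_point f g1 a \<xi> y0 u0 \<and>
           u0 - x \<noteq> 0 \<and>
           backtracking_index E \<eta> \<omega> \<rho> n x (u0 - x) k0 \<and>
           (if k0 > Nmax \<and> \<beta> > 0
            then y = x \<and>
              (\<exists>u k. is_prox_point f g1 a \<xi> x u \<and>
                     backtracking_index E \<eta> \<omega> \<rho> n x (u - x) k \<and>
                     xnew = x + \<rho> ^ k *\<^sub>R (u - x))
            else y = y0 \<and> xnew = x + \<rho> ^ k0 *\<^sub>R (u0 - x)))"

(* x is an infinite sequence of iterates.  Truncated subtraction makes x (0 - 1) = x 0, which is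
   the convention that the iterate with index -1 equals the starting point. *)
definition generated_by_pABBDCA_er ::
    "('a::real_inner \<Rightarrow> real) \<Rightarrow> ('a \<Rightarrow> 'a) \<Rightarrow> ('a \<Rightarrow> real) \<Rightarrow> ('a \<Rightarrow> ereal) \<Rightarrow>
     real \<Rightarrow> real \<Rightarrow> real \<Rightarrow> real \<Rightarrow> real \<Rightarrow> real \<Rightarrow> real \<Rightarrow> nat \<Rightarrow> 'a \<Rightarrow> (nat \<Rightarrow> 'a) \<Rightarrow> bool" where
  "generated_by_pABBDCA_er f Df g1 g2 \<alpha>0 \<alpha>min \<alpha>max \<rho> \<beta>bar \<omega> \<eta> Nmax x0 x \<longleftrightarrow>
     (\<exists>\<alpha> y. x 0 = x0 \<and> \<alpha> 0 = \<alpha>0 \<and>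
        (\<forall>n. pABBDCA_er_step f g1 g2 \<rho> \<beta>bar \<omega> \<eta> Nmax n (\<alpha> n) (x (n - 1)) (x n) (y n) (x (Suc n)) \<and>
             \<alpha> (Suc n) =
               bb_stepsize \<alpha>min \<alpha>max n (x (Suc n) - y n) (Df (x (Suc n)) - Df (y n))))"

end

theory Submission
  imports Defs
begin

text \<open>
  The slack \<open>\<omega> / (n + 1) * norm d^2\<close> makes the line search nonmonotone, but only for finitely many
  iterations, and this reduces the theorem to the convergence theory of descent methods for
  Kurdyka-Lojasiewicz functions. The point is that the accepted step sizes \<open>\<rho> ^ k\<close> stay away from
  zero. For \<open>n \<ge> 2\<close> the extrapolation parameter is positive, so a line search with more than \<open>Nmax\<close>
  reductions triggers a restart from \<open>x n\<close> itself. The proximal point \<open>u\<close> computed there satisfies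
  \<open>E u \<le> E (x n) - 1 / \<alpha> * norm (u - x n)^2\<close>, and \<open>\<eta> < 1 / \<alpha>max \<le> 1 / \<alpha>\<close>, so the unit step is accepted at
  once. Hence \<open>\<rho> ^ Nmax \<le> \<rho> ^ k \<le> 1\<close>, and as soon as \<open>\<omega> / (n + 1) \<le> \<eta> * \<rho> ^ Nmax / 2\<close> the slack is
  absorbed by half of the guaranteed decrease.

  With \<open>D n = norm (x (n + 1) - x n)\<close>, the tail of the sequence therefore has two properties
  (lemma \<open>pABBDCA_er_step_estimates\<close>): sufficient decrease
  \<open>E (x (n + 1)) \<le> E (x n) - \<eta> / 2 * D n^2\<close>, and a subgradient of \<open>E\<close> at \<open>x n\<close> of norm at most
  \<open>C * (D n + D (n - 1))\<close>. The second comes from the optimality condition of the proximal problem: it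
  expresses the chosen \<open>\<xi>\<close> through gradients at \<open>u\<close>, which the Lipschitz conditions compare with those
  at \<open>x n\<close>. The previous step length enters because the proximal centre is extrapolated.

  Theorem \<open>KL_descent_sequence_converges\<close> then applies. Compact level sets give a cluster point \<open>c\<close>, at
  which the values of \<open>E\<close> converge, and it is critical because the subgradients tend to zero and the
  subdifferential has closed graph. The inequality at \<open>c\<close>, together with concavity of the
  desingularizing function \<open>\<psi>\<close>, turns the two properties into
  \<open>2 * D (n + 1) \<le> D n + (\<phi> n - \<phi> (n + 1))\<close>, where \<open>\<phi> n\<close> is a multiple of
  \<open>\<psi> (E (x (n + 1)) - E c)\<close>. This telescopes, so an iterate that is close enough to \<open>c\<close> traps all later
  ones, and the total length is finite. Boundedness of \<open>E\<close> from below forces \<open>g2\<close> to be finite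
  everywhere, so \<open>E\<close> is real-valued and continuous, which the argument uses throughout.
\<close>

section \<open>Real-valued extended convex functions\<close>

lemma convex_on_of_convex_ereal_epigraph:
  fixes G :: "'a::real_normed_vector \<Rightarrow> real"
  assumes "convex (ereal_epigraph (\<lambda>z. ereal (G z)))"
  shows "convex_on UNIV G"
proof -
  have "ereal_epigraph (\<lambda>z. ereal (G z)) = epigraph UNIV G"
    by (auto simp: ereal_epigraph_def epigraph_def)
  then show ?thesis
    using assms convex_epigraph by metis
qed

lemma subdifferential_ereal_iff:
  "v \<in> subdifferential (\<lambda>z. ereal (G z)) x \<longleftrightarrow> (\<forall>y. G x + v \<bullet> (y - x) \<le> G y)"
  by (simp add: subdifferential_def)

lemma subdifferential_closed_graph:
  fixes G :: "'a::real_inner \<Rightarrow> real"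
  assumes cont: "continuous_on UNIV G"
    and mem: "\<And>n. \<xi> n \<in> subdifferential (\<lambda>z. ereal (G z)) (z n)"
    and "z \<longlonglongrightarrow> l" "\<xi> \<longlonglongrightarrow> v"
  shows "v \<in> subdifferential (\<lambda>z. ereal (G z)) l"
  unfolding subdifferential_ereal_iff
proof
  fix y
  have "(\<lambda>n. G (z n)) \<longlonglongrightarrow> G l"
    using cont assms(3) by (rule continuous_on_tendsto_compose) auto
  then have "(\<lambda>n. G (z n) + \<xi> n \<bullet> (y - z n)) \<longlonglongrightarrow> G l + v \<bullet> (y - l)"
    by (intro tendsto_intros assms)
  then show "G l + v \<bullet> (y - l) \<le> G y"
    by (rule LIMSEQ_le_const2) (use mem in \<open>auto simp: subdifferential_ereal_iff\<close>)
qed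

section \<open>The proximal subproblem\<close>

lemma prox_point_stationary:
  fixes f g1 :: "'a::real_inner \<Rightarrow> real"
  assumes "GDERIV f u :> p" "GDERIV g1 u :> q"
    and prox: "is_prox_point f g1 a \<xi> y u" and "a \<noteq> 0"
  shows "\<xi> = p + q + (1 / a) *\<^sub>R (u - y)"
proof -
  let ?J = "\<lambda>z. (- \<xi>) \<bullet> (z - y) + 1 / (2 * a) * (norm (z - y))\<^sup>2 + f z + g1 z"
  let ?J' = "\<lambda>h. (- \<xi>) \<bullet> h + 1 / (2 * a) * (2 * ((u - y) \<bullet> h)) + h \<bullet> p + h \<bullet> q"
  have "(?J has_derivative ?J') (at u)"
    using assms(1,2) \<open>a \<noteq> 0\<close> unfolding gderiv_def power2_norm_eq_inner
    by (auto intro!: derivative_eq_intros simp: inner_commute)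
  moreover have "\<forall>z. ?J u \<le> ?J z"
    using prox by (simp add: is_prox_point_def is_arg_min_linorder)
  ultimately have zero: "?J' = (\<lambda>h. 0)"
    by (intro has_derivative_local_min) auto
  \<comment> \<open>The derivative is the inner product with this vector, so evaluating it there gives its square.\<close>
  define d where "d = u - y"
  let ?w = "p + q + (1 / a) *\<^sub>R d - \<xi>"
  have "?J' h = h \<bullet> ?w" for h
    using \<open>a \<noteq> 0\<close> unfolding d_def[symmetric]
    by (simp add: inner_diff_right inner_add_right inner_commute[of _ h])
  then have "?w \<bullet> ?w = 0"
    using fun_cong[OF zero, of ?w] by metis
  then show ?thesis by (simp add: d_def)
qed

text \<open>
  Strong convexity of the proximal problem yields the factor \<open>1 / a\<close>; comparing the values at \<open>u\<close> and
  \<open>x\<close> directly would give only half of it. Instead \<open>u\<close> is compared with the points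
  \<open>(1 - t) u + t x\<close>, and \<open>t\<close> tends to \<open>0\<close> after division by \<open>t\<close>. The full factor matters, since the
  line search parameter \<open>\<eta>\<close> may be arbitrarily close to \<open>1 / \<alpha>max\<close>.
\<close>
lemma prox_point_descent:
  fixes f g1 G :: "'a::real_inner \<Rightarrow> real"
  assumes conv: "convex_on UNIV (\<lambda>z. f z + g1 z)"
    and sub: "\<xi> \<in> subdifferential (\<lambda>z. ereal (G z)) x"
    and prox: "is_prox_point f g1 a \<xi> x u" and "a > 0"
  shows "f u + g1 u - G u \<le> f x + g1 x - G x - 1 / a * (norm (u - x))\<^sup>2"
proof -
  let ?F = "\<lambda>z. f z + g1 z" and ?q = "(norm (u - x))\<^sup>2"
  have bound: "1 / a * ?q - 1 / (2 * a) * ?q * t \<le> ?F x - ?F u + \<xi> \<bullet> (u - x)"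
    if t: "0 < t" "t \<le> 1" for t
  proof -
    define z where "z = (1 - t) *\<^sub>R u + t *\<^sub>R x"
    have zx: "z - x = (1 - t) *\<^sub>R (u - x)"
      by (simp add: z_def algebra_simps)
    have Fz: "?F z \<le> (1 - t) * ?F u + t * ?F x"
      using conv t unfolding z_def by (intro convex_onD) auto
    define I c where "I = \<xi> \<bullet> (u - x)" and "c = 1 / (2 * a) * ?q"
    have "(- \<xi>) \<bullet> (u - x) + 1 / (2 * a) * ?q + f u + g1 u \<le>
          (- \<xi>) \<bullet> (z - x) + 1 / (2 * a) * (norm (z - x))\<^sup>2 + f z + g1 z"
      using prox by (simp add: is_prox_point_def is_arg_min_linorder)
    also have "(- \<xi>) \<bullet> (z - x) = - ((1 - t) * I)"
      by (simp add: zx I_def)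
    also have "1 / (2 * a) * (norm (z - x))\<^sup>2 = (1 - t)\<^sup>2 * c"
      by (simp add: zx c_def power_mult_distrib)
    finally have "- I + c + ?F u \<le> - ((1 - t) * I) + (1 - t)\<^sup>2 * c + ?F z"
      by (simp add: I_def c_def)
    then have "t * (2 * c - c * t) \<le> t * (?F x - ?F u + I)"
      using Fz by (simp add: power2_eq_square algebra_simps)
    then have "2 * c - c * t \<le> ?F x - ?F u + I"
      using t by simp
    then show ?thesis
      by (simp add: I_def c_def)
  qed
  have "((\<lambda>t. 1 / a * ?q - 1 / (2 * a) * ?q * t) \<longlongrightarrow> 1 / a * ?q - 1 / (2 * a) * ?q * 0) (at_right 0)"
    by (intro tendsto_intros)
  moreover have "eventually (\<lambda>t. 1 / a * ?q - 1 / (2 * a) * ?q * t \<le> ?F x - ?F u + \<xi> \<bullet> (u - x))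
      (at_right 0)"
    unfolding eventually_at_right_field using bound by (intro exI[of _ 1]) auto
  ultimately have "1 / a * ?q \<le> ?F x - ?F u + \<xi> \<bullet> (u - x)"
    using tendsto_upperbound by fastforce
  moreover have "G x + \<xi> \<bullet> (u - x) \<le> G u"
    using sub by (simp add: subdifferential_ereal_iff)
  ultimately show ?thesis by simp
qed

section \<open>Descent sequences of Kurdyka-Lojasiewicz functions\<close>

text \<open>
  The inequality in the definition involves \<open>\<psi>'\<close> at the current value only. By concavity,
  \<open>\<psi>' s * (s - t) \<le> \<psi> s - \<psi> t\<close>, so the derivative can be eliminated: a decrease of the function from
  \<open>s\<close> to \<open>t\<close> is paid for by a decrease of \<open>\<psi>\<close> times the norm of any subgradient. The radius \<open>\<nu>\<close> is
  shrunk to a finite one, and the neighbourhood to a ball.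
\<close>
lemma KL_desingularization:
  fixes e :: "'a::real_normed_vector \<Rightarrow> real"
  assumes KL: "KL_function (\<lambda>z. ereal (e z)) dh" and crit: "0 \<in> dh c"
  obtains \<nu> r :: real and \<psi> :: "real \<Rightarrow> real"
  where "\<nu> > 0" "r > 0" "\<psi> 0 = 0" "continuous_on {0..<\<nu>} \<psi>"
    "\<And>t. t \<in> {0..<\<nu>} \<Longrightarrow> 0 \<le> \<psi> t"
    "\<And>z v t. \<lbrakk>norm (z - c) < r; v \<in> dh z; 0 \<le> t; t \<le> e z - e c; 0 < e z - e c; e z - e c < \<nu>\<rbrakk>
       \<Longrightarrow> e z - e c - t \<le> norm v * (\<psi> (e z - e c) - \<psi> t)"
proof -
  obtain N :: ereal and U \<psi> \<psi>' where N: "0 < N" "open U" "c \<in> U"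
    and cont: "continuous_on {t. 0 \<le> t \<and> ereal t < N} \<psi>"
    and conc: "concave_on {t. 0 \<le> t \<and> ereal t < N} \<psi>"
    and nonneg: "\<forall>t. 0 \<le> t \<and> ereal t < N \<longrightarrow> 0 \<le> \<psi> t"
    and psi0: "\<psi> 0 = 0"
    and deriv: "\<forall>t. 0 < t \<and> ereal t < N \<longrightarrow> (\<psi> has_real_derivative \<psi>' t) (at t)"
    and kl: "\<forall>x\<in>U. ereal (e c) < ereal (e x) \<and> ereal (e x) < ereal (e c) + N \<longrightarrow>
        1 \<le> ereal (\<psi>' (real_of_ereal (ereal (e x) - ereal (e c)))) * dist_origin (dh x)"
    and pos: "\<forall>t. 0 < t \<and> ereal t < N \<longrightarrow> 0 < \<psi>' t"
    using KL crit unfolding KL_function_def by blast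
  obtain \<nu> where nu: "0 < ereal \<nu>" "ereal \<nu> < N"
    using ereal_dense2[OF \<open>0 < N\<close>] by auto
  have below: "ereal t < N" if "t < \<nu>" for t
    using that nu(2) by (metis ereal_less_eq(3) less_imp_le order_le_less_trans)
  have sub: "{0..<\<nu>} \<subseteq> {t. 0 \<le> t \<and> ereal t < N}"
    using below by auto
  obtain r where r: "r > 0" "ball c r \<subseteq> U"
    using N open_contains_ball by blast
  show thesis
  proof (rule that[of \<nu> r \<psi>])
    show "continuous_on {0..<\<nu>} \<psi>"
      using cont sub by (rule continuous_on_subset)
    show "0 \<le> \<psi> t" if "t \<in> {0..<\<nu>}" for t
      using nonneg sub that by blast
    fix z v t
    assume z: "norm (z - c) < r" and v: "v \<in> dh z" and t: "0 \<le> t" "t \<le> e z - e c"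
      and s: "0 < e z - e c" "e z - e c < \<nu>"
    let ?s = "e z - e c"
    have "z \<in> U"
      using r z by (auto simp: subset_iff dist_norm norm_minus_commute)
    moreover have "ereal (e z) < ereal (e c) + N"
      using below[OF s(2)] by (cases N) auto
    ultimately have "1 \<le> ereal (\<psi>' ?s) * dist_origin (dh z)"
      using kl s by force
    also have "\<dots> \<le> ereal (\<psi>' ?s) * ereal (norm v)"
      using pos s below v unfolding dist_origin_def
      by (intro ereal_mult_left_mono INF_lower) (auto simp: less_imp_le)
    finally have one: "1 \<le> \<psi>' ?s * norm v"
      by simp
    have concv: "convex_on {0..<\<nu>} (\<lambda>t. - \<psi> t)"
      using conc sub unfolding concave_on_def by (rule convex_on_subset) simp
    have "((\<lambda>t. - \<psi> t) has_real_derivative - \<psi>' ?s) (at ?s within {0..<\<nu>})"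
      using deriv s below by (simp add: DERIV_minus has_field_derivative_at_within)
    moreover have "?s \<in> interior {0..<\<nu>}" "t \<in> {0..<\<nu>}"
      using s t by simp_all
    moreover have "connected {0..<\<nu>}"
      by (rule convex_connected) simp
    ultimately have "- \<psi>' ?s * (t - ?s) \<le> - \<psi> t - - \<psi> ?s"
      using convex_on_imp_above_tangent[OF concv] by blast
    then have tangent: "\<psi>' ?s * (?s - t) \<le> \<psi> ?s - \<psi> t"
      by (simp add: algebra_simps)
    have "?s - t \<le> (\<psi>' ?s * norm v) * (?s - t)"
      using one t mult_right_mono[of 1 "\<psi>' ?s * norm v" "?s - t"] by simp
    also have "\<dots> = norm v * (\<psi>' ?s * (?s - t))"
      by simp
    also have "\<dots> \<le> norm v * (\<psi> ?s - \<psi> t)"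
      using tangent by (rule mult_left_mono) simp
    finally show "?s - t \<le> norm v * (\<psi> ?s - \<psi> t)" .
  qed (use nu r psi0 in auto)
qed

text \<open>
  The recursion may be used only inside the ball, and that the sequence stays in the ball has to be
  derived from the recursion. Both follow from one invariant: the length travelled since \<open>w 1\<close> plus
  the last step plus \<open>\<phi>\<close> does not increase.
\<close>
lemma trapped_sequence_finite_length:
  fixes w :: "nat \<Rightarrow> 'a::real_normed_vector" and \<phi> :: "nat \<Rightarrow> real"
  assumes step: "\<And>n. norm (w (Suc n) - c) < r \<Longrightarrow>
      2 * norm (w (Suc (Suc n)) - w (Suc n)) \<le> norm (w (Suc n) - w n) + (\<phi> n - \<phi> (Suc n))"
    and nonneg: "\<And>n. 0 \<le> \<phi> n"
    and start: "norm (w 1 - c) + norm (w 1 - w 0) + \<phi> 0 < r"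
  shows "summable (\<lambda>n. norm (w (Suc n) - w n))"
proof -
  define D where "D n = norm (w (Suc n) - w n)" for n
  define S where "S m = (\<Sum>j<m. D (Suc j))" for m
  have near: "norm (w (Suc m) - c) \<le> norm (w 1 - c) + S m" for m
  proof (induction m)
    case (Suc m)
    have "norm (w (Suc (Suc m)) - c) \<le> norm (w (Suc m) - c) + D (Suc m)"
      unfolding D_def using norm_triangle_ineq[of "w (Suc m) - c" "w (Suc (Suc m)) - w (Suc m)"] by simp
    then show ?case using Suc by (simp add: S_def)
  qed (simp add: S_def)
  have bound: "S m + D m + \<phi> m \<le> D 0 + \<phi> 0" for m
  proof (induction m)
    case (Suc m)
    have "0 \<le> D m"
      by (simp add: D_def)
    moreover have "norm (w 1 - c) + D 0 + \<phi> 0 < r"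
      using start by (simp add: D_def)
    ultimately have "norm (w (Suc m) - c) < r"
      using near[of m] Suc nonneg[of m] by linarith
    then have "2 * D (Suc m) \<le> D m + (\<phi> m - \<phi> (Suc m))"
      unfolding D_def by (rule step)
    then show ?case using Suc by (simp add: S_def)
  qed (simp add: S_def)
  have "S m \<le> D 0 + \<phi> 0" for m
  proof -
    have "0 \<le> D m"
      by (simp add: D_def)
    then show ?thesis
      using bound[of m] nonneg[of m] by linarith
  qed
  then have "summable (\<lambda>j. D (Suc j))"
    unfolding S_def by (intro bounded_imp_summable[where B = "D 0 + \<phi> 0"])
      (auto simp: D_def lessThan_Suc_atMost[symmetric] simp del: sum.lessThan_Suc)
  then show ?thesis
    unfolding D_def by (rule summable_Suc_iff[THEN iffD1])
qed

text \<open>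
  The arithmetic that makes step lengths summable: the coefficient of \<open>d'\<close> is half that of \<open>d\<close>, so
  the linear recursion is a contraction up to the term \<open>k\<close>, which telescopes in its application.
\<close>
lemma quadratic_recursion_imp_linear:
  fixes d d' k :: real
  assumes "d\<^sup>2 \<le> k * (d + d')" "0 \<le> d" "0 \<le> d'" "0 \<le> k"
  shows "2 * d \<le> d' + 4 * k"
proof (rule ccontr)
  assume "\<not> 2 * d \<le> d' + 4 * k"
  then have less: "4 * k < 2 * d - d'" by simp
  then have "d > 0" using assms by linarith
  then have "4 * k * (d + d') < (2 * d - d') * (d + d')"
    using less assms by (intro mult_strict_right_mono) auto
  then have "2 * d\<^sup>2 + d'\<^sup>2 < d * d'"
    using assms(1) by (simp add: power2_eq_square algebra_simps)
  moreover have "2 * (d * d') \<le> d\<^sup>2 + d'\<^sup>2"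
    using sum_squares_bound[of d d'] by simp
  moreover have "0 \<le> d * d'" using assms by simp
  ultimately show False
    using zero_le_power2[of d] by linarith
qed

text \<open>
  A cluster point \<open>c\<close> is critical, so the inequality holds near \<open>c\<close>, and combining it with the
  decrease and the subgradient bound gives \<open>D (n + 1)^2 \<le> K * \<Delta> * (D (n + 1) + D n)\<close>, where \<open>\<Delta>\<close> is the
  decrease of \<open>\<psi>\<close>. The previous two lemmas then bound the length once some iterate near \<open>c\<close> is reached
  with a small last step and a small value of \<open>\<psi>\<close>. The subdifferential \<open>dh\<close> is arbitrary up to
  closedness of its graph at \<open>0\<close>. The bound is stated for the subgradient at \<open>w (n + 1)\<close>
  because it involves the steps before and after that point.
\<close>
theorem KL_descent_sequence_converges:
  fixes e :: "'a::euclidean_space \<Rightarrow> real" and w :: "nat \<Rightarrow> 'a"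
  assumes KL: "KL_function (\<lambda>z. ereal (e z)) dh"
    and cont: "continuous_on UNIV e"
    and closed: "\<And>z v l. \<lbrakk>z \<longlonglongrightarrow> l; v \<longlonglongrightarrow> 0; \<And>n. v n \<in> dh (z n)\<rbrakk> \<Longrightarrow> 0 \<in> dh l"
    and bdd: "bounded (range w)"
    and "a > 0" and decrease: "\<And>n. e (w (Suc n)) \<le> e (w n) - a * (norm (w (Suc n) - w n))\<^sup>2"
    and "C \<ge> 0" and subgrad: "\<And>n. \<exists>v\<in>dh (w (Suc n)).
        norm v \<le> C * (norm (w (Suc (Suc n)) - w (Suc n)) + norm (w (Suc n) - w n))"
  shows "\<exists>c. w \<longlonglongrightarrow> c \<and> 0 \<in> dh c \<and> summable (\<lambda>n. norm (w (Suc n) - w n))"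
proof -
  define D where "D n = norm (w (Suc n) - w n)" for n
  have D0: "0 \<le> D n" for n by (simp add: D_def)
  obtain c s where sub: "strict_mono s" "(w \<circ> s) \<longlonglongrightarrow> c"
    using bounded_imp_convergent_subsequence[OF bdd] by blast
  have dec: "decseq (\<lambda>n. e (w n))"
    using decrease \<open>a > 0\<close> by (intro decseq_SucI) (smt (verit) mult_nonneg_nonneg zero_le_power2)
  have es: "(\<lambda>k. e (w (s k))) \<longlonglongrightarrow> e c"
    using continuous_on_tendsto_compose[OF cont sub(2)] by (simp add: o_def)
  have ge: "e c \<le> e (w n)" for n
  proof (rule LIMSEQ_le_const2[OF es])
    show "\<exists>N. \<forall>k\<ge>N. e (w (s k)) \<le> e (w n)"
      using dec seq_suble[OF sub(1)] unfolding decseq_def by (meson order_trans)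
  qed
  have lim: "(\<lambda>n. e (w n)) \<longlonglongrightarrow> e c"
  proof -
    obtain l where l: "(\<lambda>n. e (w n)) \<longlonglongrightarrow> l"
      using decseq_convergent[OF dec, of "e c"] ge by blast
    then have "(\<lambda>k. e (w (s k))) \<longlonglongrightarrow> l"
      using LIMSEQ_subseq_LIMSEQ[OF l sub(1)] by (simp add: o_def)
    then show ?thesis using l es LIMSEQ_unique by blast
  qed
  have limD: "D \<longlonglongrightarrow> 0"
  proof -
    have g: "(\<lambda>n. (e (w n) - e (w (Suc n))) / a) \<longlonglongrightarrow> (e c - e c) / a"
      using \<open>a > 0\<close> by (intro tendsto_intros lim LIMSEQ_Suc) auto
    have le: "(D n)\<^sup>2 \<le> (e (w n) - e (w (Suc n))) / a" for n
      using decrease[of n] \<open>a > 0\<close> by (simp add: D_def field_simps)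
    have "(\<lambda>n. (D n)\<^sup>2) \<longlonglongrightarrow> 0"
    proof (rule Lim_null_comparison)
      show "\<forall>\<^sub>F n in sequentially. norm ((D n)\<^sup>2) \<le> (e (w n) - e (w (Suc n))) / a"
        using le by (intro always_eventually allI) simp
      show "(\<lambda>n. (e (w n) - e (w (Suc n))) / a) \<longlonglongrightarrow> 0"
        using g by simp
    qed
    then show ?thesis
      using D0 tendsto_real_sqrt[of "\<lambda>n. (D n)\<^sup>2" 0 sequentially] by simp
  qed
  obtain v where v: "\<And>n. v n \<in> dh (w (Suc n))" "\<And>n. norm (v n) \<le> C * (D (Suc n) + D n)"
    using subgrad unfolding D_def by metis
  have limv: "v \<longlonglongrightarrow> 0"
  proof (rule Lim_null_comparison)
    show "(\<lambda>n. C * (D (Suc n) + D n)) \<longlonglongrightarrow> 0"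
      by (intro tendsto_mult_right_zero tendsto_add_zero LIMSEQ_Suc limD)
  qed (use v in auto)
  \<comment> \<open>Steps are indexed by their starting point, so the step that arrives at \<open>w (s k)\<close> is number
    \<open>s k - 1\<close>.\<close>
  have ev_pred: "filterlim (\<lambda>k. s k - 1) sequentially sequentially"
    using filterlim_compose[OF filterlim_minus_const_nat_at_top filterlim_subseq[OF sub(1)]] .
  have ev_pos: "eventually (\<lambda>k. Suc (s k - 1) = s k) sequentially"
    using eventually_gt_at_top[of 0]
  proof eventually_elim
    case (elim k)
    then show ?case using seq_suble[OF sub(1), of k] by simp
  qed
  have limws: "(\<lambda>k. w (Suc (s k - 1))) \<longlonglongrightarrow> c"
    by (rule Lim_transform_eventually[OF sub(2)[unfolded o_def]])
      (use ev_pos in eventually_elim, simp)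
  have crit: "0 \<in> dh c"
    by (rule closed[OF limws filterlim_compose[OF limv ev_pred]]) (rule v(1))
  obtain \<nu> r \<psi> where psi: "\<nu> > 0" "r > 0" "\<psi> 0 = 0" "continuous_on {0..<\<nu>} \<psi>"
    "\<And>t. t \<in> {0..<\<nu>} \<Longrightarrow> 0 \<le> \<psi> t"
    and kl: "\<And>z v t. \<lbrakk>norm (z - c) < r; v \<in> dh z; 0 \<le> t; t \<le> e z - e c; 0 < e z - e c; e z - e c < \<nu>\<rbrakk>
       \<Longrightarrow> e z - e c - t \<le> norm v * (\<psi> (e z - e c) - \<psi> t)"
    using KL_desingularization[OF KL crit] by blast
  define K where "K = C / a"
  have K: "K \<ge> 0" using \<open>C \<ge> 0\<close> \<open>a > 0\<close> by (simp add: K_def)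
  define \<phi> where "\<phi> n = 4 * (K * \<psi> (e (w (Suc n)) - e c))" for n
  have ev_nu: "eventually (\<lambda>n. e (w n) - e c < \<nu>) sequentially"
    using lim \<open>\<nu> > 0\<close> by (intro order_tendstoD(2)[where y = 0] ) (auto simp: LIM_zero_iff)
  have limphi: "\<phi> \<longlonglongrightarrow> 0"
  proof -
    have "(\<lambda>n. \<psi> (e (w n) - e c)) \<longlonglongrightarrow> \<psi> 0"
    proof (rule continuous_on_tendsto_compose[OF psi(4)])
      show "(\<lambda>n. e (w n) - e c) \<longlonglongrightarrow> 0" using lim by (simp add: LIM_zero_iff)
      show "\<forall>\<^sub>F n in sequentially. e (w n) - e c \<in> {0..<\<nu>}"
        using ev_nu by eventually_elim (use ge in auto)
    qed (use psi in auto)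
    then show ?thesis
      unfolding \<phi>_def psi(3) by (intro tendsto_mult_right_zero LIMSEQ_Suc)
  qed
  have step: "2 * D (Suc n) \<le> D n + (\<phi> n - \<phi> (Suc n))"
    if nu: "e (w (Suc n)) - e c < \<nu>" and near: "norm (w (Suc n) - c) < r" for n
  proof (cases "e (w (Suc n)) = e c")
    \<comment> \<open>Once the limiting value is attained the sequence is constant; the inequality for \<open>\<psi>\<close> covers
      only larger values.\<close>
    case True
    then have "e (w (Suc (Suc n))) = e c"
      using dec ge[of "Suc (Suc n)"] decseq_SucD[OF dec, of "Suc n"] by simp
    moreover from this True have "a * (D (Suc n))\<^sup>2 \<le> 0"
      using decrease[of "Suc n"] by (simp add: D_def)
    then have "D (Suc n) = 0"
      using \<open>a > 0\<close> by (simp add: mult_le_0_iff)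
    ultimately show ?thesis
      using True D0 by (simp add: \<phi>_def)
  next
    case False
    let ?s = "e (w (Suc n)) - e c" and ?t = "e (w (Suc (Suc n))) - e c"
    let ?\<Delta> = "\<psi> ?s - \<psi> ?t"
    have st: "0 < ?s" "0 \<le> ?t" "?t \<le> ?s"
      using False ge[of "Suc n"] ge[of "Suc (Suc n)"] decseq_SucD[OF dec, of "Suc n"] by auto
    have A: "?s - ?t \<le> norm (v n) * ?\<Delta>"
      using kl[OF near v(1) st(2,3,1) nu] by simp
    have B: "a * (D (Suc n))\<^sup>2 \<le> ?s - ?t"
      using decrease[of "Suc n"] by (simp add: D_def)
    \<comment> \<open>Monotonicity of \<open>\<psi>\<close>, read off from the desingularized inequality itself.\<close>
    have \<Delta>: "0 \<le> ?\<Delta>"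
    proof (rule ccontr)
      assume "\<not> 0 \<le> ?\<Delta>"
      then have neg: "norm (v n) * ?\<Delta> \<le> 0" by (simp add: mult_le_0_iff)
      then have "?s = ?t" using A st by linarith
      then show False using \<open>\<not> 0 \<le> ?\<Delta>\<close> by simp
    qed
    have "norm (v n) * ?\<Delta> \<le> C * (D (Suc n) + D n) * ?\<Delta>"
      using v(2) \<Delta> by (rule mult_right_mono)
    then have "a * (D (Suc n))\<^sup>2 \<le> C * (D (Suc n) + D n) * ?\<Delta>"
      using A B by linarith
    then have "(D (Suc n))\<^sup>2 \<le> (K * ?\<Delta>) * (D (Suc n) + D n)"
      using \<open>a > 0\<close> by (simp add: K_def field_simps)
    then have "2 * D (Suc n) \<le> D n + 4 * (K * ?\<Delta>)"
      using D0 K \<Delta> by (intro quadratic_recursion_imp_linear) auto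
    then show ?thesis
      by (simp add: \<phi>_def algebra_simps)
  qed
  have "eventually (\<lambda>n. D n < r / 3) sequentially" "eventually (\<lambda>n. \<phi> n < r / 3) sequentially"
    using limD limphi \<open>r > 0\<close> by (auto intro!: order_tendstoD(2)[where y = 0])
  moreover note ev_nu
  ultimately have "eventually (\<lambda>n. D n < r / 3 \<and> \<phi> n < r / 3 \<and> e (w n) - e c < \<nu>) sequentially"
    by eventually_elim simp
  then have ev1: "eventually (\<lambda>k. D (s k - 1) < r / 3 \<and> \<phi> (s k - 1) < r / 3
      \<and> e (w (s k - 1)) - e c < \<nu>) sequentially"
    using ev_pred by (rule eventually_compose_filterlim)
  have "eventually (\<lambda>k. norm (w (Suc (s k - 1)) - c) < r / 3) sequentially"
    using tendstoD[OF limws, of "r / 3"] \<open>r > 0\<close> by (simp add: dist_norm)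
  with ev1 obtain k where k: "D (s k - 1) < r / 3" "\<phi> (s k - 1) < r / 3"
      "e (w (s k - 1)) - e c < \<nu>" "norm (w (Suc (s k - 1)) - c) < r / 3"
    using eventually_happens[OF eventually_conj] sequentially_bot by blast
  define p where "p = s k - 1"
  note k = k[folded p_def]
  have nup: "e (w (n + p)) - e c < \<nu>" for n
    using k(3) decseqD[OF dec, of p "n + p"] by simp
  have "summable (\<lambda>n. norm (w (Suc n + p) - w (n + p)))"
  proof (rule trapped_sequence_finite_length[where c = c and r = r and \<phi> = "\<lambda>n. \<phi> (n + p)"])
    fix n
    show "0 \<le> \<phi> (n + p)"
      using K psi(5)[of "e (w (Suc n + p)) - e c"] nup[of "Suc n"] ge[of "Suc n + p"]
      by (simp add: \<phi>_def)
    show "2 * norm (w (Suc (Suc n) + p) - w (Suc n + p)) \<le>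
      norm (w (Suc n + p) - w (n + p)) + (\<phi> (n + p) - \<phi> (Suc n + p))"
      if "norm (w (Suc n + p) - c) < r"
      using step[of "n + p"] nup[of "Suc n"] that by (simp add: D_def)
  next
    show "norm (w (1 + p) - c) + norm (w (1 + p) - w (0 + p)) + \<phi> (0 + p) < r"
      using k by (simp add: D_def)
  qed
  then have summ: "summable (\<lambda>n. norm (w (Suc n) - w n))"
    using summable_iff_shift[of "\<lambda>n. norm (w (Suc n) - w n)" p] by simp
  have "convergent w"
    using summable_norm_cancel[OF summ]
    by (simp add: summable_iff_convergent sum_lessThan_telescope convergent_diff_const_right_iff)
  then obtain c' where c': "w \<longlonglongrightarrow> c'"
    unfolding convergent_def by blast
  then have "c' = c"
    using LIMSEQ_subseq_LIMSEQ[OF c' sub(1)] sub(2) LIMSEQ_unique by blast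
  then show ?thesis
    using c' crit summ by blast
qed

section \<open>The iterates of the algorithm\<close>

lemma sufficient_decrease_ereal_iff:
  "sufficient_decrease (\<lambda>z. ereal (e z)) \<eta> \<omega> n x d l \<longleftrightarrow>
     e (x + l *\<^sub>R d) \<le> e x - (\<eta> * l - \<omega> / (real n + 1)) * (norm d)\<^sup>2"
  by (simp add: sufficient_decrease_def algebra_simps)

text \<open>
  Both branches of an iteration have a common description: a proximal point \<open>u\<close> for the centre \<open>y\<close>
  in use and a step size with at most \<open>Nmax\<close> reductions. For a restart the exponent is even \<open>0\<close>,
  because the descent of the proximal point from \<open>x\<close> passes the test at the unit step. The bound
  \<open>2 \<le> n\<close> is where the extrapolation parameter becomes positive, so that a restart is possible.
\<close>
lemma pABBDCA_er_step_linesearch: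
  fixes f g1 G :: "'a::real_inner \<Rightarrow> real"
  defines "e \<equiv> \<lambda>z. f z + g1 z - G z"
  assumes step: "pABBDCA_er_step f g1 (\<lambda>z. ereal (G z)) \<rho> \<beta>bar \<omega> \<eta> Nmax n a xprev x y xnew"
    and conv: "convex_on UNIV (\<lambda>z. f z + g1 z)"
    and n: "2 \<le> n" and b: "0 < \<beta>bar" "\<beta>bar \<le> 1" and a: "0 < a" "\<eta> \<le> 1 / a" and "0 \<le> \<omega>"
  obtains \<xi> u k
  where "\<xi> \<in> subdifferential (\<lambda>z. ereal (G z)) x" "is_prox_point f g1 a \<xi> y u"
    "k \<le> Nmax" "xnew = x + \<rho> ^ k *\<^sub>R (u - x)"
    "e xnew \<le> e x - (\<eta> * \<rho> ^ k - \<omega> / (real n + 1)) * (norm (u - x))\<^sup>2"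
    "norm (y - x) \<le> norm (x - xprev)"
proof -
  let ?E = "\<lambda>z. ereal (e z)" and ?\<beta> = "extrapolation \<beta>bar n"
  have E: "dc_objective f g1 (\<lambda>z. ereal (G z)) = ?E"
    by (simp add: dc_objective_def e_def fun_eq_iff)
  have beta: "0 < ?\<beta>" "?\<beta> \<le> 1"
    using n b by (auto simp: extrapolation_def)
  obtain \<xi> u0 k0 where \<xi>: "\<xi> \<in> subdifferential (\<lambda>z. ereal (G z)) x"
    and u0: "is_prox_point f g1 a \<xi> (x + ?\<beta> *\<^sub>R (x - xprev)) u0"
    and k0: "backtracking_index ?E \<eta> \<omega> \<rho> n x (u0 - x) k0"
    and branch: "if k0 > Nmax \<and> ?\<beta> > 0
            then y = x \<and>
              (\<exists>u k. is_prox_point f g1 a \<xi> x u \<and>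
                     backtracking_index ?E \<eta> \<omega> \<rho> n x (u - x) k \<and>
                     xnew = x + \<rho> ^ k *\<^sub>R (u - x))
            else y = x + ?\<beta> *\<^sub>R (x - xprev) \<and> xnew = x + \<rho> ^ k0 *\<^sub>R (u0 - x)"
    using step unfolding pABBDCA_er_step_def Let_def E by blast
  show thesis
  proof (cases "k0 > Nmax")
    case True
    then obtain u k where y: "y = x" and u: "is_prox_point f g1 a \<xi> x u"
      and k: "backtracking_index ?E \<eta> \<omega> \<rho> n x (u - x) k"
      and xnew: "xnew = x + \<rho> ^ k *\<^sub>R (u - x)"
      using branch beta by auto
    have "e u \<le> e x - 1 / a * (norm (u - x))\<^sup>2"
      unfolding e_def using prox_point_descent[OF conv \<xi> u a(1)] .
    moreover have "\<eta> * (norm (u - x))\<^sup>2 \<le> 1 / a * (norm (u - x))\<^sup>2"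
      using a(2) by (rule mult_right_mono) simp
    moreover have "0 \<le> \<omega> / (real n + 1) * (norm (u - x))\<^sup>2"
      using \<open>0 \<le> \<omega>\<close> by simp
    ultimately have "e u \<le> e x - (\<eta> - \<omega> / (real n + 1)) * (norm (u - x))\<^sup>2"
      unfolding left_diff_distrib by linarith
    then have unit: "sufficient_decrease ?E \<eta> \<omega> n x (u - x) (\<rho> ^ 0)"
      by (simp add: sufficient_decrease_ereal_iff)
    have "k = 0"
      using k unit unfolding backtracking_index_def by blast
    then show ?thesis
      using that[OF \<xi> _ _ xnew] u y k unfolding backtracking_index_def sufficient_decrease_ereal_iff xnew
      by simp
  next
    case False
    then have y: "y = x + ?\<beta> *\<^sub>R (x - xprev)" and xnew: "xnew = x + \<rho> ^ k0 *\<^sub>R (u0 - x)"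
      using branch by auto
    have "norm (y - x) \<le> norm (x - xprev)"
      using beta mult_right_mono[of ?\<beta> 1 "norm (x - xprev)"] by (simp add: y)
    then show ?thesis
      using that[OF \<xi> _ _ xnew] u0 False k0 y
      unfolding backtracking_index_def sufficient_decrease_ereal_iff xnew by simp
  qed
qed

text \<open>
  The line search controls \<open>d = u - x\<close>, whereas the convergence argument needs the actual steps
  \<open>\<rho> ^ k * d\<close>. Since \<open>\<rho> ^ Nmax \<le> \<rho> ^ k \<le> 1\<close>, the decrease in terms of \<open>d\<close> is at least that in terms of
  the step, and \<open>norm d\<close> is at most the step length divided by \<open>\<rho> ^ Nmax\<close>.
\<close>
lemma pABBDCA_er_step_estimates:
  fixes f g1 G :: "'a::real_inner \<Rightarrow> real"
  defines "e \<equiv> \<lambda>z. f z + g1 z - G z"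
  assumes step: "pABBDCA_er_step f g1 (\<lambda>z. ereal (G z)) \<rho> \<beta>bar \<omega> \<eta> Nmax n a xprev x y xnew"
    and conv: "convex_on UNIV (\<lambda>z. f z + g1 z)"
    and f: "\<And>z. GDERIV f z :> Df z" "L-lipschitz_on UNIV Df"
    and g1: "\<And>z. GDERIV g1 z :> Dg1 z" "M-lipschitz_on UNIV Dg1"
    and n: "2 \<le> n" and b: "0 < \<beta>bar" "\<beta>bar \<le> 1"
    and a: "0 < \<alpha>min" "\<alpha>min \<le> a" "\<eta> \<le> 1 / a" and "0 \<le> \<omega>" "0 < \<eta>"
    and \<rho>: "0 < \<rho>" "\<rho> \<le> 1" and slack: "\<omega> / (real n + 1) \<le> \<eta> * \<rho> ^ Nmax / 2"
  shows "e xnew \<le> e x - \<eta> / 2 * (norm (xnew - x))\<^sup>2"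
    and "\<exists>v\<in>dc_subdifferential Df Dg1 (\<lambda>z. ereal (G z)) x.
      norm v \<le> (L + M + 1 / \<alpha>min) / \<rho> ^ Nmax * (norm (xnew - x) + norm (x - xprev))"
proof -
  have "0 < a" using a by simp
  obtain \<xi> u k where \<xi>: "\<xi> \<in> subdifferential (\<lambda>z. ereal (G z)) x"
    and u: "is_prox_point f g1 a \<xi> y u"
    and k: "k \<le> Nmax" and xnew: "xnew = x + \<rho> ^ k *\<^sub>R (u - x)"
    and decr: "e xnew \<le> e x - (\<eta> * \<rho> ^ k - \<omega> / (real n + 1)) * (norm (u - x))\<^sup>2"
    and y: "norm (y - x) \<le> norm (x - xprev)"
    unfolding e_def
    using pABBDCA_er_step_linesearch[OF step conv n b \<open>0 < a\<close> a(3) \<open>0 \<le> \<omega>\<close>] by blast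
  define l where "l = \<rho> ^ k"
  define d where "d = norm (u - x)"
  have lmin: "\<rho> ^ Nmax \<le> l" "0 < \<rho> ^ Nmax" and l: "0 < l" "l \<le> 1"
    using k \<rho> by (simp_all add: l_def power_decreasing power_le_one)
  have d: "0 \<le> d" and xd: "norm (xnew - x) = l * d"
    using l by (simp_all add: d_def xnew l_def)
  show "e xnew \<le> e x - \<eta> / 2 * (norm (xnew - x))\<^sup>2"
  proof -
    have "\<eta> * \<rho> ^ Nmax \<le> \<eta> * l"
      using lmin \<open>0 < \<eta>\<close> by simp
    then have "\<eta> / 2 * l \<le> \<eta> * l - \<omega> / (real n + 1)"
      using slack by linarith
    moreover have "\<eta> / 2 * l\<^sup>2 \<le> \<eta> / 2 * l"
      using l \<open>0 < \<eta>\<close> power_decreasing[of 1 2 l] by simp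
    ultimately have "\<eta> / 2 * l\<^sup>2 * d\<^sup>2 \<le> (\<eta> * l - \<omega> / (real n + 1)) * d\<^sup>2"
      by (intro mult_right_mono) auto
    then show ?thesis
      using decr unfolding xd l_def[symmetric] d_def[symmetric] by (simp add: power_mult_distrib)
  qed
  show "\<exists>v\<in>dc_subdifferential Df Dg1 (\<lambda>z. ereal (G z)) x.
      norm v \<le> (L + M + 1 / \<alpha>min) / \<rho> ^ Nmax * (norm (xnew - x) + norm (x - xprev))"
  proof (rule bexI)
    let ?v = "Df x + Dg1 x - \<xi>" and ?l = "\<rho> ^ Nmax" and ?p = "norm (x - xprev)"
    show "?v \<in> dc_subdifferential Df Dg1 (\<lambda>z. ereal (G z)) x"
      using \<xi> by (auto simp: dc_subdifferential_def)
    have LM: "0 \<le> L" "0 \<le> M"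
      using f(2) g1(2) by (auto dest: lipschitz_on_nonneg)
    have "\<xi> = Df u + Dg1 u + (1 / a) *\<^sub>R (u - y)"
      using prox_point_stationary[OF f(1) g1(1) u] \<open>0 < a\<close> by simp
    then have "?v = (Df x - Df u) + (Dg1 x - Dg1 u) + (1 / a) *\<^sub>R ((y - x) + (x - u))"
      by (simp add: algebra_simps)
    then have "norm ?v \<le> norm (Df x - Df u) + norm (Dg1 x - Dg1 u)
        + norm ((1 / a) *\<^sub>R ((y - x) + (x - u)))"
      by (simp only: norm_triangle_mono order_refl)
    also have "norm (Df x - Df u) \<le> L * d"
      using lipschitz_onD[OF f(2), of x u] by (simp add: dist_norm d_def norm_minus_commute)
    also have "norm (Dg1 x - Dg1 u) \<le> M * d"
      using lipschitz_onD[OF g1(2), of x u] by (simp add: dist_norm d_def norm_minus_commute)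
    also have "norm ((1 / a) *\<^sub>R ((y - x) + (x - u))) \<le> 1 / \<alpha>min * (?p + d)"
    proof -
      have "norm ((y - x) + (x - u)) \<le> ?p + d"
        using norm_triangle_ineq[of "y - x" "x - u"] y by (simp add: d_def norm_minus_commute)
      moreover have "1 / a \<le> 1 / \<alpha>min"
        using a by (simp add: frac_le)
      ultimately have "1 / a * norm ((y - x) + (x - u)) \<le> 1 / \<alpha>min * (?p + d)"
        using a by (intro mult_mono) auto
      then show ?thesis
        using \<open>0 < a\<close> by simp
    qed
    finally have "norm ?v \<le> L * d + M * d + 1 / \<alpha>min * (?p + d)"
      by simp
    also have "\<dots> \<le> (L + M + 1 / \<alpha>min) * (d + ?p)"
      using LM by (simp add: algebra_simps)
    also have "\<dots> \<le> (L + M + 1 / \<alpha>min) * ((l * d + ?p) / ?l)"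
    proof (rule mult_left_mono)
      have "?l * d \<le> l * d"
        using lmin d by (intro mult_right_mono) auto
      moreover have "?l * ?p \<le> 1 * ?p"
        using lmin l by (intro mult_right_mono) auto
      ultimately show "d + ?p \<le> (l * d + ?p) / ?l"
        using lmin(2) by (simp add: pos_le_divide_eq algebra_simps)
    qed (use LM a in simp)
    finally show "norm ?v \<le> (L + M + 1 / \<alpha>min) / ?l * (norm (xnew - x) + ?p)"
      unfolding xd by simp
  qed
qed

lemma bb_stepsize_bounds:
  assumes "\<alpha>min \<le> \<alpha>max"
  shows "\<alpha>min \<le> bb_stepsize \<alpha>min \<alpha>max n s v" "bb_stepsize \<alpha>min \<alpha>max n s v \<le> \<alpha>max"
  using assms by (auto simp: bb_stepsize_def)

text \<open>
  The objective is \<open>-\<infinity>\<close> wherever \<open>g2\<close> is \<open>\<infinity>\<close>, and properness excludes the value \<open>-\<infinity>\<close>.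
\<close>
lemma bounded_below_dc_objective_imp_real_valued:
  assumes proper: "proper_closed_convex g2"
    and below: "\<forall>z. ereal m \<le> dc_objective f g1 g2 z"
  obtains G where "g2 = (\<lambda>z. ereal (G z))"
proof
  show "g2 = (\<lambda>z. ereal (real_of_ereal (g2 z)))"
  proof
    fix z
    have "g2 z \<noteq> -\<infinity>"
      using proper by (simp add: proper_closed_convex_def proper_closed_def)
    moreover have "g2 z \<noteq> \<infinity>"
      using below[rule_format, of z] by (auto simp: dc_objective_def)
    ultimately show "g2 z = ereal (real_of_ereal (g2 z))"
      by (cases "g2 z") auto
  qed
qed

lemma dc_subdifferential_closed_graph:
  fixes G :: "'a::real_inner \<Rightarrow> real"
  assumes cont: "continuous_on UNIV G" "continuous_on UNIV Df" "continuous_on UNIV Dg1"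
    and z: "z \<longlonglongrightarrow> l" and v: "v \<longlonglongrightarrow> w"
    and mem: "\<And>n. v n \<in> dc_subdifferential Df Dg1 (\<lambda>z. ereal (G z)) (z n)"
  shows "w \<in> dc_subdifferential Df Dg1 (\<lambda>z. ereal (G z)) l"
proof -
  have "(\<lambda>n. Df (z n) + Dg1 (z n) - v n) \<longlonglongrightarrow> Df l + Dg1 l - w"
    by (intro tendsto_intros v continuous_on_tendsto_compose[OF cont(2) z]
        continuous_on_tendsto_compose[OF cont(3) z]) auto
  moreover have "Df (z n) + Dg1 (z n) - v n \<in> subdifferential (\<lambda>z. ereal (G z)) (z n)" for n
    using mem[of n] by (auto simp: dc_subdifferential_def)
  ultimately have "Df l + Dg1 l - w \<in> subdifferential (\<lambda>z. ereal (G z)) l"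
    by (intro subdifferential_closed_graph[OF cont(1) _ z])
  then show ?thesis
    unfolding dc_subdifferential_def by (intro CollectI exI[of _ "Df l + Dg1 l - w"]) simp
qed

theorem theorem4:
  fixes f g1 :: "'a::euclidean_space \<Rightarrow> real"
    and g2 :: "'a \<Rightarrow> ereal"
    and Df Dg1 :: "'a \<Rightarrow> 'a"
    and x :: "nat \<Rightarrow> 'a" and x0 :: 'a
    and L M \<alpha>0 \<alpha>min \<alpha>max \<rho> \<beta>bar \<omega> \<eta> :: real
    and Nmax :: nat
  assumes f_convex: "convex_on UNIV f"
    and f_grad: "\<And>z. GDERIV f z :> Df z"
    and f_grad_lipschitz: "L-lipschitz_on UNIV Df"
    and g1_convex: "proper_closed_convex (\<lambda>z. ereal (g1 z))"
    and g1_grad: "\<And>z. GDERIV g1 z :> Dg1 z"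
    and g1_grad_lipschitz: "M-lipschitz_on UNIV Dg1"
    and g2_convex: "proper_closed_convex g2"
    and E_bounded_below: "\<exists>m::real. \<forall>z. ereal m \<le> dc_objective f g1 g2 z"
    and E_level_compact: "\<And>a::real. compact {z. dc_objective f g1 g2 z \<le> ereal a}"
    and E_KL: "KL_function (dc_objective f g1 g2) (dc_subdifferential Df Dg1 g2)"
    and "\<alpha>0 > 0" and "0 < \<alpha>min" and "\<alpha>min < \<alpha>max"
    and "0 < \<rho>" and "\<rho> < 1"
    and "0 < \<beta>bar" and "\<beta>bar < 1"
    and "0 < \<omega>" and "\<omega> < 1"
    and "0 < \<eta>" and "\<eta> < 1 / \<alpha>max"
    and "Nmax \<ge> 1"
    and generated:
      "generated_by_pABBDCA_er f Df g1 g2 \<alpha>0 \<alpha>min \<alpha>max \<rho> \<beta>bar \<omega> \<eta> Nmax x0 x"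
  shows "\<exists>xstar. x \<longlonglongrightarrow> xstar \<and>
           0 \<in> dc_subdifferential Df Dg1 g2 xstar \<and>
           summable (\<lambda>n. norm (x (Suc n) - x n))"
proof -
  obtain G where G: "g2 = (\<lambda>z. ereal (G z))"
    using bounded_below_dc_objective_imp_real_valued[OF g2_convex] E_bounded_below by blast
  define e where "e z = f z + g1 z - G z" for z
  have E: "dc_objective f g1 g2 = (\<lambda>z. ereal (e z))"
    by (simp add: dc_objective_def e_def G fun_eq_iff)
  have g1conv: "convex_on UNIV g1" and Gconv: "convex_on UNIV G"
    using g1_convex g2_convex unfolding G proper_closed_convex_def
    by (simp_all add: convex_on_of_convex_ereal_epigraph)
  have conv: "convex_on UNIV (\<lambda>z. f z + g1 z)"
    using f_convex g1conv by (rule convex_on_add)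
  have contG: "continuous_on UNIV G"
    using Gconv by (rule convex_on_continuous[OF open_UNIV])
  have conte: "continuous_on UNIV e"
    unfolding e_def
    by (intro continuous_intros contG convex_on_continuous[OF open_UNIV] f_convex g1conv)
  have lmin: "0 < \<eta> * \<rho> ^ Nmax"
    using \<open>0 < \<eta>\<close> \<open>0 < \<rho>\<close> by simp
  obtain \<alpha> y where step: "\<And>n. pABBDCA_er_step f g1 g2 \<rho> \<beta>bar \<omega> \<eta> Nmax n (\<alpha> n)
      (x (n - 1)) (x n) (y n) (x (Suc n))"
    and alpha: "\<And>n. \<alpha> (Suc n) =
      bb_stepsize \<alpha>min \<alpha>max n (x (Suc n) - y n) (Df (x (Suc n)) - Df (y n))"
    using generated unfolding generated_by_pABBDCA_er_def by blast
  have "(\<lambda>n. \<omega> / (real n + 1)) \<longlonglongrightarrow> 0"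
    using LIMSEQ_Suc[OF lim_const_over_n[of \<omega>]] by (simp add: add.commute)
  then have "eventually (\<lambda>n. \<omega> / (real n + 1) < \<eta> * \<rho> ^ Nmax / 2) sequentially"
    using lmin by (intro order_tendstoD(2)) auto
  then obtain N where N: "\<And>n. n \<ge> N \<Longrightarrow> \<omega> / (real n + 1) < \<eta> * \<rho> ^ Nmax / 2"
    unfolding eventually_sequentially by blast
  \<comment> \<open>From index \<open>p\<close> on the slack is absorbed, restarts are possible, and the step size is one that the
    Barzilai-Borwein rule has clipped to \<open>[\<alpha>min, \<alpha>max]\<close>, unlike \<open>\<alpha>0\<close>.\<close>
  define p where "p = N + 2"
  define w where "w n = x (n + p)" for n
  define C where "C = (L + M + 1 / \<alpha>min) / \<rho> ^ Nmax"
  have est: "e (x (Suc n)) \<le> e (x n) - \<eta> / 2 * (norm (x (Suc n) - x n))\<^sup>2 \<and>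
      (\<exists>v\<in>dc_subdifferential Df Dg1 g2 (x n).
        norm v \<le> C * (norm (x (Suc n) - x n) + norm (x n - x (n - 1))))" if "n \<ge> p" for n
  proof -
    have n: "2 \<le> n" "\<omega> / (real n + 1) \<le> \<eta> * \<rho> ^ Nmax / 2"
      using that N[of n] by (auto simp: p_def)
    then obtain n' where n': "n = Suc n'"
      by (cases n) auto
    have a: "\<alpha>min \<le> \<alpha> n" "\<alpha> n \<le> \<alpha>max"
      using bb_stepsize_bounds \<open>\<alpha>min < \<alpha>max\<close> unfolding n' alpha by (metis less_imp_le)+
    have "1 / \<alpha>max \<le> 1 / \<alpha> n"
      using a \<open>0 < \<alpha>min\<close> by (intro divide_left_mono) auto
    then have \<eta>: "\<eta> \<le> 1 / \<alpha> n"
      using \<open>\<eta> < 1 / \<alpha>max\<close> by linarith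
    show ?thesis
      unfolding e_def C_def G
      using pABBDCA_er_step_estimates[OF step[of n, unfolded G] conv f_grad f_grad_lipschitz
          g1_grad g1_grad_lipschitz n(1) \<open>0 < \<beta>bar\<close> less_imp_le[OF \<open>\<beta>bar < 1\<close>] \<open>0 < \<alpha>min\<close> a(1) \<eta>
          less_imp_le[OF \<open>0 < \<omega>\<close>] \<open>0 < \<eta>\<close> \<open>0 < \<rho>\<close> less_imp_le[OF \<open>\<rho> < 1\<close>] n(2)]
      by blast
  qed
  have decr: "e (w (Suc n)) \<le> e (w n) - \<eta> / 2 * (norm (w (Suc n) - w n))\<^sup>2" for n
    using est[of "n + p"] by (simp add: w_def)
  have "\<exists>c. w \<longlonglongrightarrow> c \<and> 0 \<in> dc_subdifferential Df Dg1 g2 c \<and>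
      summable (\<lambda>n. norm (w (Suc n) - w n))"
  proof (rule KL_descent_sequence_converges[where a = "\<eta> / 2" and C = C and e = e])
    show "KL_function (\<lambda>z. ereal (e z)) (dc_subdifferential Df Dg1 g2)"
      using E_KL unfolding E .
    show "0 \<in> dc_subdifferential Df Dg1 g2 l"
      if "z \<longlonglongrightarrow> l" "v \<longlonglongrightarrow> 0" "\<And>n. v n \<in> dc_subdifferential Df Dg1 g2 (z n)" for z v l
      using dc_subdifferential_closed_graph[OF contG
          lipschitz_on_continuous_on[OF f_grad_lipschitz]
          lipschitz_on_continuous_on[OF g1_grad_lipschitz] that(1,2)] that(3)
      unfolding G by blast
    have "decseq (\<lambda>n. e (w n))"
    proof (rule decseq_SucI)
      fix n
      have "0 \<le> \<eta> / 2 * (norm (w (Suc n) - w n))\<^sup>2"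
        using \<open>0 < \<eta>\<close> by simp
      then show "e (w (Suc n)) \<le> e (w n)"
        using decr[of n] by linarith
    qed
    then have "range w \<subseteq> {z. dc_objective f g1 g2 z \<le> ereal (e (w 0))}"
      unfolding E by (auto simp: decseq_def)
    then show "bounded (range w)"
      using E_level_compact compact_imp_bounded bounded_subset by blast
    show "C \<ge> 0"
      using \<open>0 < \<alpha>min\<close> \<open>0 < \<rho>\<close> lipschitz_on_nonneg[OF f_grad_lipschitz]
        lipschitz_on_nonneg[OF g1_grad_lipschitz] by (simp add: C_def)
    show "\<exists>v\<in>dc_subdifferential Df Dg1 g2 (w (Suc n)).
        norm v \<le> C * (norm (w (Suc (Suc n)) - w (Suc n)) + norm (w (Suc n) - w n))" for n
      using est[of "Suc n + p"] by (simp add: w_def)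
  qed (use conte decr \<open>0 < \<eta>\<close> in auto)
  then obtain c where c: "w \<longlonglongrightarrow> c" "0 \<in> dc_subdifferential Df Dg1 g2 c"
    "summable (\<lambda>n. norm (w (Suc n) - w n))"
    by blast
  have "x \<longlonglongrightarrow> c"
    using c(1) unfolding w_def by (rule LIMSEQ_offset)
  moreover have "summable (\<lambda>n. norm (x (Suc n) - x n))"
    using c(3) summable_iff_shift[of "\<lambda>n. norm (x (Suc n) - x n)" p] by (simp add: w_def)
  ultimately show ?thesis
    using c(2) by blast
qed

end
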